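(* Let $p,q,r,s\in\mathbb{R}$ and let $f(x)=x^{4}+px^{3}+qx^{2}+rx+s$. Define $$\begin{aligned} D={}&18p^{3}qrs-4p^{2}q^{3}s+144qr^{2}s+p^{2}q^{2}r^{2}-192prs^{2}+144p^{2}qs^{2}+18pqr^{3}-4p^{3}r^{3}-128q^{2}s^{2}\\ &+16q^{4}s-4q^{3}r^{2}-27p^{4}s^{2}-80pq^{2}rs-6p^{2}r^{2}s+256s^{3}-27r^{4},\\ L_1={}&p^{2}q^{2}-3p^{3}r-6p^{2}s-4q^{3}+14pqr+16qs-18r^{2},\\ C_0={}&48rs-32pqs-p^{2}qr+9p^{3}s+4q^{2}r-3pr^{2},\\ D_2={}&3C_0^{2}+2qL_1^{2}+3pC_0L_1,\\ D_3={}&(8r-4pq+p^{3})(q^{2}-3pr+12s). \end{aligned}$$ Then: (1) $f$ has 4 distinct real roots if and only if $3p^{2}-8q>0$ and $L_1>0$ and $D>0$. (2) $f$ has 2 distinct real roots, both single, and 2 (non-real) complex conjugate roots if and only if $D<0$. (3) $f$ has 4 distinct non-real complex roots (all single) if and only if $D>0$ and ($3p^{2}-8q\le 0$ or $L_1\le 0$). (4) $f$ has 1 real double root and 2 real single roots (three distinct real roots) if and only if $D=0$ and $L_1>0$. Moreover, in this case: (4a) single root $<$ double root $<$ single root if and only if $D_2<0$; (4b) double root $<$ single root $<$ single root if and only if $D_2>0$ and $D_3<0$; (4c) single root $<$ single root $<$ double root if and only if $D_2>0$ and $D_3>0$. (5) $f$ has 1 real double root and 2 (non-real, single) complex conjugate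 roots if and only if $D=0$ and $L_1<0$. (6) $f$ has 2 distinct real double roots if and only if $D=0$ and $L_1=0$ and $3p^{2}-8q>0$ and $p^{3}-4pq+8r=0$. (7) $f$ has 2 (non-real) complex conjugate double roots if and only if $D=0$ and $L_1=0$ and $3p^{2}-8q<0$. (8) $f$ has 1 triple real root and 1 single real root if and only if $D=0$ and $L_1=0$ and $3p^{2}-8q>0$ and $p^{3}-4pq+8r\neq 0$. Moreover, in this case: (8a) triple root $<$ single root if and only if $p^{3}-4pq+8r<0$; (8b) single root $<$ triple root if and only if $p^{3}-4pq+8r>0$. (9) $f$ has a quadruple root if and only if $D=0$ and $L_1=0$ and $3p^{2}-8q=0$.
   Context: Roots are counted in $\mathbb{C}$. A single, double, triple or quadruple root is a root of multiplicity exactly 1, 2, 3 or 4, respectively. $D$ is the discriminant of the monic quartic $f$. *)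

theory Defs
  imports Complex_Main "HOL-Computational_Algebra.Polynomial"
begin

definition real_roots :: "complex poly \<Rightarrow> real set" where
  "real_roots f = {x. poly f (complex_of_real x) = 0}"

definition nonreal_roots :: "complex poly \<Rightarrow> complex set" where
  "nonreal_roots f = {z. z \<notin> \<real> \<and> poly f z = 0}"

text \<open>Multiplicity of a real number as a root, counted over the complex numbers. It is a positive
  number exactly at the real roots of a nonzero polynomial.\<close>

abbreviation real_mult :: "real \<Rightarrow> complex poly \<Rightarrow> nat" where
  "real_mult x f \<equiv> order (complex_of_real x) f"

end

theory Submission
  imports Defs "HOL-Computational_Algebra.Fundamental_Theorem_Algebra"
begin

text \<open>
  The three quantities that decide the pattern of roots are, up to positive factors, the principal
  minors of the Hankel matrix of power sums, hence sums over the pairs, the triples and the single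
  quadruple of roots of squared Vandermonde products: \<open>3*p^2 - 8*q\<close>, \<open>2 * L1\<close> and \<open>D\<close>
  (lemmas \<open>sum_sq_diff_roots\<close>, \<open>quartic_L1_roots\<close>, \<open>quartic_disc_roots\<close>). For real roots the squares
  are nonnegative, so it only matters how many roots are distinct. A conjugate pair \<open>z\<close>, \<open>cnj z\<close>
  contributes the negative square \<open>(z - cnj z)^2\<close>, while its other factors combine to squared
  distances; this gives all the remaining signs. The one inequality that does not follow at sight is
  that two conjugate pairs never make \<open>3*p^2 - 8*q\<close> and \<open>L1\<close> positive together
  (\<open>two_pairs_L1_neg\<close>).

  The roots of a real quartic, counted with multiplicity, consist of zero, one or two conjugate pairs
  and of real roots (\<open>real_poly_splits\<close>), and listing the coincidences yields nine patterns. Each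
  pattern entails its sign condition (\<open>root_type_exists\<close>). The patterns exclude each other, as do
  the sign conditions, so every implication is an equivalence (\<open>has_type_iff_sign_cond\<close>).

  If \<open>d\<close> is a double root and \<open>a\<close>, \<open>b\<close> are simple ones, then \<open>C0 = 2 * d * L1\<close>, so that
  \<open>D2\<close> is \<open>L1^2\<close> times the second derivative at \<open>d\<close>, a positive multiple of
  \<open>(d-a) * (d-b)\<close>, and \<open>D3\<close> is a positive multiple of \<open>2*d - a - b\<close>
  (\<open>double_root_position\<close>). For a triple root \<open>t\<close> and a simple root \<open>a\<close> one has
  \<open>p^3 - 4*p*q + 8*r = (t - a)^3\<close>. The signs of these expressions tell the order of the roots.
\<close>

section \<open>The invariants as functions of the roots\<close>

definition quartic_disc :: "'a::comm_ring_1 \<Rightarrow> 'a \<Rightarrow> 'a \<Rightarrow> 'a \<Rightarrow> 'a" where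
  "quartic_disc p q r s = 18*p^3*q*r*s - 4*p^2*q^3*s + 144*q*r^2*s + p^2*q^2*r^2 - 192*p*r*s^2
        + 144*p^2*q*s^2 + 18*p*q*r^3 - 4*p^3*r^3 - 128*q^2*s^2
        + 16*q^4*s - 4*q^3*r^2 - 27*p^4*s^2 - 80*p*q^2*r*s - 6*p^2*r^2*s + 256*s^3 - 27*r^4"

text \<open>Up to the factor 2 this is the subdiscriminant of order 1 of the quartic with coefficients \<open>p\<close>,
  \<open>q\<close>, \<open>r\<close>, \<open>s\<close>, i.e. the leading \<open>3 \<times> 3\<close> minor of the Hankel matrix of the power sums of the
  roots.\<close>

definition quartic_L1 :: "'a::comm_ring_1 \<Rightarrow> 'a \<Rightarrow> 'a \<Rightarrow> 'a \<Rightarrow> 'a" where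
  "quartic_L1 p q r s = p^2*q^2 - 3*p^3*r - 6*p^2*s - 4*q^3 + 14*p*q*r + 16*q*s - 18*r^2"

text \<open>The relations between coefficients and roots are stated over any commutative ring, so that the
  identities below serve for real roots and, over the complex numbers, for conjugate pairs.\<close>

definition vieta :: "'a::comm_ring_1 \<Rightarrow> 'a \<Rightarrow> 'a \<Rightarrow> 'a \<Rightarrow> 'a \<Rightarrow> 'a \<Rightarrow> 'a \<Rightarrow> 'a \<Rightarrow> bool" where
  "vieta p q r s a b c d \<longleftrightarrow> p = -(a + b + c + d) \<and> q = a*b + a*c + a*d + b*c + b*d + c*d
     \<and> r = -(a*b*c + a*b*d + a*c*d + b*c*d) \<and> s = a*b*c*d"

lemma vieta_of_real:
  "vieta (of_real p) (of_real q) (of_real r) (of_real s)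
     (of_real a) (of_real b) (of_real c) (of_real d :: 'a::{real_algebra_1,comm_ring_1}) \<longleftrightarrow> vieta p q r s a b c d"
  unfolding vieta_def
  by (simp only: of_real_add [symmetric] of_real_mult [symmetric] of_real_minus [symmetric] of_real_eq_iff)

lemma quartic_disc_of_real: "quartic_disc (of_real p) (of_real q) (of_real r) (of_real s)
    = (of_real (quartic_disc p q r s) :: 'a::{real_algebra_1,comm_ring_1})"
  by (simp add: quartic_disc_def)

lemma quartic_L1_of_real: "quartic_L1 (of_real p) (of_real q) (of_real r) (of_real s)
    = (of_real (quartic_L1 p q r s) :: 'a::{real_algebra_1,comm_ring_1})"
  by (simp add: quartic_L1_def)

lemma quartic_disc_roots:
  fixes a b c d :: "'a::idom"
  assumes "vieta p q r s a b c d"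
  shows "quartic_disc p q r s = ((a-b) * (a-c) * (a-d) * (b-c) * (b-d) * (c-d))^2"
proof -
  have *: "p = -(a+b+c+d)" "q = a*b+a*c+a*d+b*c+b*d+c*d" "r = -(a*b*c+a*b*d+a*c*d+b*c*d)" "s = a*b*c*d"
    using assms by (auto simp: vieta_def)
  show ?thesis unfolding quartic_disc_def * by algebra
qed

text \<open>By the Cauchy-Binet formula the \<open>3 \<times> 3\<close> Hankel minor is the sum, over the triples of roots, of
  the squared Vandermonde products; hence it is nonzero for real roots exactly when at least three of
  them are distinct.\<close>

lemma quartic_L1_roots:
  fixes a b c d :: "'a::idom"
  assumes "vieta p q r s a b c d"
  shows "2 * quartic_L1 p q r s = ((a-b) * (a-c) * (b-c))^2 + ((a-b) * (a-d) * (b-d))^2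
     + ((a-c) * (a-d) * (c-d))^2 + ((b-c) * (b-d) * (c-d))^2"
proof -
  have *: "p = -(a+b+c+d)" "q = a*b+a*c+a*d+b*c+b*d+c*d" "r = -(a*b*c+a*b*d+a*c*d+b*c*d)" "s = a*b*c*d"
    using assms by (auto simp: vieta_def)
  show ?thesis unfolding quartic_L1_def * by algebra
qed

text \<open>The \<open>2 \<times> 2\<close> Hankel minor: the sum of the squared Vandermonde products over the pairs.\<close>

lemma sum_sq_diff_roots:
  fixes a b c d :: "'a::idom"
  assumes "vieta p q r s a b c d"
  shows "3*p^2 - 8*q = (a-b)^2 + (a-c)^2 + (a-d)^2 + (b-c)^2 + (b-d)^2 + (c-d)^2"
proof -
  have *: "p = -(a+b+c+d)" "q = a*b+a*c+a*d+b*c+b*d+c*d"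
    using assms by (auto simp: vieta_def)
  show ?thesis unfolding * by algebra
qed

text \<open>A symmetric function that vanishes when the roots split into two pairs with the same sum; it is
  what tells two double roots from a triple and a single one.\<close>

lemma split_diff_roots:
  fixes a b c d :: "'a::idom"
  assumes "vieta p q r s a b c d"
  shows "p^3 - 4*p*q + 8*r = - ((a+b-c-d) * (a+c-b-d) * (a+d-b-c))"
proof -
  have *: "p = -(a+b+c+d)" "q = a*b+a*c+a*d+b*c+b*d+c*d" "r = -(a*b*c+a*b*d+a*c*d+b*c*d)"
    using assms by (auto simp: vieta_def)
  show ?thesis unfolding * by algebra
qed

text \<open>If \<open>d\<close> is the only multiple root and is exactly double, the greatest common divisor of the quartic and
  its derivative is their subresultant of degree 1, a multiple of \<open>2 * L1 * x - C0\<close>; its root is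
  \<open>d\<close>.\<close>

lemma double_root_abscissa:
  fixes a b d :: "'a::idom"
  assumes "vieta p q r s d d a b"
  shows "48*r*s - 32*p*q*s - p^2*q*r + 9*p^3*s + 4*q^2*r - 3*p*r^2 = 2 * d * quartic_L1 p q r s"
proof -
  have *: "p = -(d+d+a+b)" "q = d*d+d*a+d*b+d*a+d*b+a*b" "r = -(d*d*a+d*d*b+d*a*b+d*a*b)" "s = d*d*a*b"
    using assms by (auto simp: vieta_def)
  show ?thesis unfolding quartic_L1_def * by algebra
qed

text \<open>With \<open>C = 2 * d * L\<close> the first quantity is \<open>L^2\<close> times the second derivative of the quartic at its
  double root \<open>d\<close>, so its sign says whether \<open>d\<close> lies between the single roots. In the second one both
  factors are invariant under translation, and for \<open>d = 0\<close> they are \<open>- (a+b) * (a-b)^2\<close> and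
  \<open>(a*b)^2\<close>; its sign compares \<open>d\<close> with the midpoint of the single roots.\<close>

lemma double_root_position:
  fixes a b d :: "real"
  assumes v: "vieta p q r s d d a b" and C: "C = 2 * d * L"
  shows "3 * C^2 + 2*q * L^2 + 3*p * C * L = 2 * L^2 * ((d-a) * (d-b))"
    and "(8*r - 4*p*q + p^3) * (q^2 - 3*p*r + 12*s) = (2*d-a-b) * ((a-b) * (d-a) * (d-b))^2"
proof -
  have *: "p = -(d+d+a+b)" "q = d*d+d*a+d*b+d*a+d*b+a*b" "r = -(d*d*a+d*d*b+d*a*b+d*a*b)" "s = d*d*a*b"
    using v by (auto simp: vieta_def)
  show "3 * C^2 + 2*q * L^2 + 3*p * C * L = 2 * L^2 * ((d-a) * (d-b))"
    unfolding C * by algebra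
  show "(8*r - 4*p*q + p^3) * (q^2 - 3*p*r + 12*s) = (2*d-a-b) * ((a-b) * (d-a) * (d-b))^2"
    unfolding * by algebra
qed

section \<open>Signs of the invariants for each pattern of roots\<close>

lemma signs_four_real:
  fixes a b c d :: real
  assumes "vieta p q r s a b c d" "distinct [a, b, c, d]"
  shows "quartic_disc p q r s > 0" "quartic_L1 p q r s > 0" "3*p^2 - 8*q > 0"
proof -
  show "quartic_disc p q r s > 0"
    using assms(2) by (simp add: quartic_disc_roots[OF assms(1)])
  have "((a-b) * (a-c) * (b-c))^2 > 0" "(a - b)^2 > 0"
    using assms(2) by auto
  with quartic_L1_roots[OF assms(1)] sum_sq_diff_roots[OF assms(1)] 
  show "quartic_L1 p q r s > 0" "3*p^2 - 8*q > 0"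
    by (smt (verit) zero_le_power2)+
qed

lemma signs_double_singles:
  fixes a b d :: real
  assumes "vieta p q r s d d a b" "distinct [d, a, b]"
  shows "quartic_disc p q r s = 0" "quartic_L1 p q r s > 0"
proof -
  show "quartic_disc p q r s = 0" by (simp add: quartic_disc_roots[OF assms(1)])
  have "((d-a) * (d-b) * (a-b))^2 > 0" using assms(2) by auto
  thus "quartic_L1 p q r s > 0" using quartic_L1_roots[OF assms(1)] by (smt (verit) zero_le_power2)
qed

lemma signs_two_doubles:
  fixes a b :: real
  assumes "vieta p q r s a a b b" "a \<noteq> b"
  shows "quartic_disc p q r s = 0" "quartic_L1 p q r s = 0" "3*p^2 - 8*q > 0" "p^3 - 4*p*q + 8*r = 0"
  using assms(2) quartic_disc_roots[OF assms(1)] quartic_L1_roots[OF assms(1)] sum_sq_diff_roots[OF assms(1)]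
    split_diff_roots[OF assms(1)]
  by (auto intro!: add_pos_pos)

lemma signs_triple_single:
  fixes a t :: real
  assumes "vieta p q r s t t t a" "t \<noteq> a"
  shows "quartic_disc p q r s = 0" "quartic_L1 p q r s = 0" "3*p^2 - 8*q > 0" "p^3 - 4*p*q + 8*r = (t - a)^3"
  using assms(2) quartic_disc_roots[OF assms(1)] quartic_L1_roots[OF assms(1)] sum_sq_diff_roots[OF assms(1)]
    split_diff_roots[OF assms(1)]
  by (auto intro!: add_pos_pos simp: power3_eq_cube algebra_simps)

lemma signs_quadruple:
  fixes t :: real
  assumes "vieta p q r s t t t t"
  shows "quartic_disc p q r s = 0" "quartic_L1 p q r s = 0" "3*p^2 - 8*q = 0"
  using quartic_disc_roots[OF assms] quartic_L1_roots[OF assms] sum_sq_diff_roots[OF assms] by auto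

text \<open>For a conjugate pair the factors of the discriminant are grouped into the squared distances
  \<open>(x - z) * (x - cnj z)\<close>, which are positive, and the single negative factor \<open>(z - cnj z)^2\<close>.\<close>

lemma disc_one_pair:
  fixes a b :: real and z :: complex
  assumes "vieta (of_real p) (of_real q) (of_real r) (of_real s) (of_real a) (of_real b) z (cnj z)"
  shows "quartic_disc p q r s = - (4 * (Im z)^2 * (a-b)^2 * (((a - Re z)^2 + (Im z)^2) * ((b - Re z)^2 + (Im z)^2))^2)"
proof -
  have *: "(of_real x - z) * (of_real x - cnj z) = of_real ((x - Re z)^2 + (Im z)^2)" for x
    by (simp add: complex_eq_iff power2_eq_square algebra_simps)
  have zz: "(z - cnj z)^2 = of_real (- 4 * (Im z)^2)"
    by (simp add: complex_eq_iff power2_eq_square)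
  have "complex_of_real (quartic_disc p q r s) = (of_real a - of_real b)^2
      * (((of_real a - z) * (of_real a - cnj z)) * ((of_real b - z) * (of_real b - cnj z)))^2 * (z - cnj z)^2"
    unfolding quartic_disc_of_real[symmetric] quartic_disc_roots[OF assms] by algebra
  also have "\<dots> = of_real (- (4 * (Im z)^2 * (a-b)^2 * (((a - Re z)^2 + (Im z)^2) * ((b - Re z)^2 + (Im z)^2))^2))"
    unfolding * zz by (simp add: algebra_simps)
  finally show ?thesis unfolding of_real_eq_iff .
qed

lemma L1_double_pair:
  fixes d :: real and z :: complex
  assumes "vieta (of_real p) (of_real q) (of_real r) (of_real s) (of_real d) (of_real d) z (cnj z)"
  shows "quartic_L1 p q r s = - (4 * (Im z)^2 * ((d - Re z)^2 + (Im z)^2)^2)"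
proof -
  have *: "(of_real x - z) * (of_real x - cnj z) = of_real ((x - Re z)^2 + (Im z)^2)" for x
    by (simp add: complex_eq_iff power2_eq_square algebra_simps)
  have zz: "(z - cnj z)^2 = of_real (- 4 * (Im z)^2)"
    by (simp add: complex_eq_iff power2_eq_square)
  have "2 * complex_of_real (quartic_L1 p q r s) = 2 * (((of_real d - z) * (of_real d - cnj z))^2 * (z - cnj z)^2)"
    unfolding quartic_L1_of_real[symmetric] quartic_L1_roots[OF assms] by (simp add: power_mult_distrib)
  also have "\<dots> = 2 * of_real (- (4 * (Im z)^2 * ((d - Re z)^2 + (Im z)^2)^2))"
    unfolding * zz by (simp add: algebra_simps)
  finally have "complex_of_real (quartic_L1 p q r s) = of_real (- (4 * (Im z)^2 * ((d - Re z)^2 + (Im z)^2)^2))"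
    by simp
  thus ?thesis unfolding of_real_eq_iff .
qed

lemma invariants_two_pairs:
  fixes z w :: complex
  assumes "vieta (of_real p) (of_real q) (of_real r) (of_real s) z (cnj z) w (cnj w)"
  defines "e \<equiv> Re z - Re w" and "v \<equiv> Im z" and "t \<equiv> Im w"
  shows "quartic_disc p q r s = 16 * v^2 * t^2 * ((e^2 + (v-t)^2) * (e^2 + (v+t)^2))^2"
    and "quartic_L1 p q r s = -4 * ((v^2+t^2) * e^4 + 2 * e^2 * (v^2-t^2)^2 + (v^2+t^2) * (v^2-t^2)^2 - 8 * e^2 * v^2 * t^2)"
    and "3*p^2 - 8*q = 4 * e^2 - 8 * (v^2 + t^2)"
proof -
  have d1: "(z - w) * (cnj z - cnj w) = of_real (e^2 + (v-t)^2)"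
    and d2: "(z - cnj w) * (cnj z - w) = of_real (e^2 + (v+t)^2)"
    by (simp_all add: complex_eq_iff power2_eq_square algebra_simps e_def v_def t_def)
  have zz: "(z - cnj z)^2 = of_real (- 4 * (v)^2)" "(w - cnj w)^2 = of_real (- 4 * (t)^2)"
    by (simp_all add: complex_eq_iff power2_eq_square v_def t_def)
  have "complex_of_real (quartic_disc p q r s) = 
      (((z - w) * (cnj z - cnj w)) * ((z - cnj w) * (cnj z - w)))^2 * (z - cnj z)^2 * (w - cnj w)^2"
    unfolding quartic_disc_of_real[symmetric] quartic_disc_roots[OF assms(1)] by algebra
  also have "\<dots> = of_real (16 * v^2 * t^2 * ((e^2 + (v-t)^2) * (e^2 + (v+t)^2))^2)"
    unfolding d1 d2 zz by (simp add: algebra_simps)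
  finally show "quartic_disc p q r s = 16 * v^2 * t^2 * ((e^2 + (v-t)^2) * (e^2 + (v+t)^2))^2"
    unfolding of_real_eq_iff .
  have i: "\<i>^2 = (-1::complex)" by simp
  (* Only differences of roots enter, so everything is a polynomial in \<open>e\<close>, \<open>v\<close>, \<open>t\<close> and the imaginary unit. *)
  have df: "z - cnj z = 2 * \<i> * of_real v" "w - cnj w = 2 * \<i> * of_real t"
     "z - w = of_real e + \<i> * of_real v - \<i> * of_real t"
     "z - cnj w = of_real e + \<i> * of_real v + \<i> * of_real t"
     "cnj z - w = of_real e - \<i> * of_real v - \<i> * of_real t"
     "cnj z - cnj w = of_real e - \<i> * of_real v + \<i> * of_real t"
    by (simp_all add: complex_eq_iff e_def v_def t_def)
  have "2 * complex_of_real (quartic_L1 p q r s) = 2 * of_real (-4 * ((v^2+t^2) * e^4 + 2 * e^2 * (v^2-t^2)^2 + (v^2+t^2) * (v^2-t^2)^2 - 8 * e^2 * v^2 * t^2))"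
    unfolding quartic_L1_of_real[symmetric] quartic_L1_roots[OF assms(1)] df of_real_add of_real_mult of_real_diff of_real_power of_real_numeral of_real_minus
    using i by algebra
  hence "complex_of_real (quartic_L1 p q r s) = of_real (-4 * ((v^2+t^2) * e^4 + 2 * e^2 * (v^2-t^2)^2 + (v^2+t^2) * (v^2-t^2)^2 - 8 * e^2 * v^2 * t^2))"
    by (rule mult_left_cancel[THEN iffD1, rotated]) simp
  thus "quartic_L1 p q r s = -4 * ((v^2+t^2) * e^4 + 2 * e^2 * (v^2-t^2)^2 + (v^2+t^2) * (v^2-t^2)^2 - 8 * e^2 * v^2 * t^2)"
    unfolding of_real_eq_iff .
  have "complex_of_real (3*p^2 - 8*q) = 3 * of_real p^2 - 8 * of_real q" by simp
  also have "\<dots> = of_real (4 * e^2 - 8 * (v^2 + t^2))"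
    unfolding sum_sq_diff_roots[OF assms(1)] df of_real_add of_real_mult of_real_diff of_real_power of_real_numeral of_real_minus
    using i by algebra
  finally show "3*p^2 - 8*q = 4 * e^2 - 8 * (v^2 + t^2)" unfolding of_real_eq_iff .
qed

text \<open>The only negative term is \<open>8 * E * V * T \<le> 2 * E * (V+T)^2\<close>, by the inequality between the arithmetic and
  the geometric mean, and \<open>(V+T) * E^2\<close> already exceeds it when \<open>E > 2 * (V+T)\<close>. In the notation of
  \<open>invariants_two_pairs\<close>, with \<open>E = e^2\<close>, \<open>V = v^2\<close>, \<open>T = t^2\<close>, this shows that two conjugate pairs
  cannot have the signs of four real roots.\<close>

lemma two_pairs_L1_neg:
  fixes E V T :: real
  assumes "V > 0" "T > 0" "E > 2 * (V + T)"
  shows "(V+T) * E^2 + 2 * E * (V-T)^2 + (V+T) * (V-T)^2 - 8 * E * V * T > 0"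
proof -
  have "2 * (V + T) > 0" using assms by simp
  hence "E > 0" using assms(3) by (rule less_trans)
  have "8 * E * V * T \<le> 2 * (V + T)^2 * E"
  proof -
    have "4 * V * T \<le> (V+T)^2" using zero_le_power2[of "V-T"] by (simp add: power2_eq_square algebra_simps)
    thus ?thesis using mult_right_mono[of "4 * V * T" "(V+T)^2" "2*E"] \<open>E > 0\<close> by (simp add: algebra_simps)
  qed
  also have "2 * (V+T)^2 * E = ((V + T) * E) * (2 * (V + T))" by (simp add: power2_eq_square)
  also have "\<dots> < ((V + T) * E) * E"
    using assms \<open>E > 0\<close> by (intro mult_strict_left_mono) auto
  finally have "8 * E * V * T < (V + T) * E^2" by (simp add: power2_eq_square mult.assoc)
  moreover have "2 * E * (V-T)^2 \<ge> 0" "(V+T) * (V-T)^2 \<ge> 0" using assms \<open>E > 0\<close> by auto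
  ultimately show ?thesis by linarith
qed


lemma signs_two_singles_pair:
  fixes a b :: real and z :: complex
  assumes "vieta (of_real p) (of_real q) (of_real r) (of_real s) (of_real a) (of_real b) z (cnj z)"
    and "a \<noteq> b" "Im z > 0"
  shows "quartic_disc p q r s < 0"
proof -
  have "(x - Re z)^2 + (Im z)^2 > 0" for x using assms(3) by (simp add: add_nonneg_pos)
  hence "4 * (Im z)^2 * (a-b)^2 * (((a - Re z)^2 + (Im z)^2) * ((b - Re z)^2 + (Im z)^2))^2 > 0"
    using assms(2,3) by (intro mult_pos_pos zero_less_power[of "_ * (_ :: real)"]) auto
  thus ?thesis unfolding disc_one_pair[OF assms(1)] by linarith
qed

lemma signs_double_pair:
  fixes d :: real and z :: complex
  assumes "vieta (of_real p) (of_real q) (of_real r) (of_real s) (of_real d) (of_real d) z (cnj z)"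
    and "Im z > 0"
  shows "quartic_disc p q r s = 0" "quartic_L1 p q r s < 0"
proof -
  show "quartic_disc p q r s = 0" unfolding disc_one_pair[OF assms(1)] by simp
  have "(x - Re z)^2 + (Im z)^2 > 0" for x using assms(2) by (simp add: add_nonneg_pos)
  hence "4 * (Im z)^2 * ((d - Re z)^2 + (Im z)^2)^2 > 0"
    using assms(2) by (intro mult_pos_pos zero_less_power) auto
  thus "quartic_L1 p q r s < 0" unfolding L1_double_pair[OF assms(1)] by linarith
qed

lemma signs_two_pairs:
  fixes z w :: complex
  assumes "vieta (of_real p) (of_real q) (of_real r) (of_real s) z (cnj z) w (cnj w)"
    and "z \<noteq> w" "Im z > 0" "Im w > 0"
  shows "quartic_disc p q r s > 0" "3*p^2 - 8*q \<le> 0 \<or> quartic_L1 p q r s \<le> 0"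
proof -
  note inv = invariants_two_pairs[OF assms(1)]
  have "(Re z - Re w)^2 + (Im z - Im w)^2 > 0"
    using assms(2) by (simp add: complex_eq_iff sum_power2_gt_zero_iff)
  moreover have "(Re z - Re w)^2 + (Im z + Im w)^2 > 0"
    using assms(3,4) by (simp add: sum_power2_gt_zero_iff)
  ultimately show "quartic_disc p q r s > 0"
    unfolding inv using assms(3,4) by (intro mult_pos_pos zero_less_power) auto
  have "quartic_L1 p q r s \<le> 0" if "3*p^2 - 8*q > 0"
  proof -
    have "(Re z - Re w)^2 > 2 * ((Im z)^2 + (Im w)^2)" using that unfolding inv by linarith
    from two_pairs_L1_neg[OF _ _ this] assms(3,4) show ?thesis
      unfolding inv by (simp add: power_mult [symmetric])
  qed
  thus "3*p^2 - 8*q \<le> 0 \<or> quartic_L1 p q r s \<le> 0" by linarith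
qed

lemma signs_double_pairs:
  fixes z :: complex
  assumes "vieta (of_real p) (of_real q) (of_real r) (of_real s) z (cnj z) z (cnj z)" "Im z > 0"
  shows "quartic_disc p q r s = 0" "quartic_L1 p q r s = 0" "3*p^2 - 8*q < 0"
  using invariants_two_pairs[OF assms(1)] assms(2) by auto

section \<open>Roots of real polynomials with multiplicity\<close>

text \<open>The roots of a real polynomial with multiplicity are the real roots \<open>R\<close>, those in the upper
  half-plane \<open>U\<close>, and the conjugates of the latter. As no other relation ties \<open>R\<close> to \<open>U\<close>, a case distinction on the multisets \<open>R\<close> and \<open>U\<close> classifies the polynomials of a given degree.\<close>

definition splits_as :: "complex poly \<Rightarrow> real multiset \<Rightarrow> complex multiset \<Rightarrow> bool" where
  "splits_as f R U \<longleftrightarrow> f \<noteq> 0 \<and> proots f = image_mset complex_of_real R + U + image_mset cnj U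
     \<and> (\<forall>z\<in>#U. Im z > 0)"

lemma proots_linear_factors: "proots (\<Prod>x\<in>#M. [:- x, 1:]) = (M :: 'a::idom multiset)"
proof (induction M)
  case (add x M)
  have "(\<Prod>x\<in>#M. [:- x, 1:]) \<noteq> 0" by (auto simp: prod_mset_zero_iff)
  hence "proots ([:- x, 1:] * (\<Prod>x\<in>#M. [:- x, 1:])) = proots [:- x, 1:] + proots (\<Prod>x\<in>#M. [:- x, 1:])"
    by (intro proots_mult) auto
  thus ?case by (simp only: add.IH image_mset_add_mset prod_mset.add_mset proots_linear_factor minus_minus) simp
qed simp

text \<open>Conjugating the factorization into linear factors of a real polynomial gives another
  factorization of the same polynomial, and the multiset of roots is unique.\<close>

lemma proots_cnj:
  assumes real: "\<And>n. coeff f n \<in> \<real>"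
  shows "image_mset cnj (proots f) = proots f"
proof (cases "f = 0")
  case False
  define M where "M = proots f"
  have f: "f = smult (lead_coeff f) (\<Prod>x\<in>#M. [:-x, 1:])"
    unfolding M_def by (rule complex_poly_decompose_multiset [symmetric])
  have lc: "cnj (lead_coeff f) = lead_coeff f" using real by (simp add: Reals_cnj_iff)
  (* Both factorizations are compared through their values. *)
  have ev: "poly (smult c (\<Prod>x\<in>#N. [:-x, 1:])) y = c * (\<Prod>x\<in>#N. y - x)" for c y :: complex and N
    by (simp add: poly_prod_mset o_def image_mset.compositionality)
  have cn: "cnj (\<Prod>x\<in>#N. y - x) = (\<Prod>x\<in>#image_mset cnj N. cnj y - x)" for y N
    by (induction N) simp_all
  have "poly f y = poly (smult (lead_coeff f) (\<Prod>x\<in>#image_mset cnj M. [:-x, 1:])) y" for y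
  proof -
    have "poly f y = cnj (poly f (cnj y))" using poly_cnj_real[OF real, of "cnj y"] by simp
    also have "\<dots> = cnj (lead_coeff f * (\<Prod>x\<in>#M. cnj y - x))" by (subst f) (simp only: ev)
    also have "\<dots> = poly (smult (lead_coeff f) (\<Prod>x\<in>#image_mset cnj M. [:-x, 1:])) y"
      by (simp only: ev complex_cnj_mult lc cn complex_cnj_cnj)
    finally show ?thesis .
  qed
  hence "f = smult (lead_coeff f) (\<Prod>x\<in>#image_mset cnj M. [:-x, 1:])" by (simp only: poly_eq_poly_eq_iff [symmetric] fun_eq_iff) blast
  hence "proots f = proots (smult (lead_coeff f) (\<Prod>x\<in>#image_mset cnj M. [:-x, 1:]))" by simp
  also have "\<dots> = image_mset cnj M" using False by (simp only: proots_smult leading_coeff_0_iff not_False_eq_True proots_linear_factors)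
  finally show ?thesis by (simp add: M_def)
qed simp

lemma real_poly_splits:
  assumes real: "\<And>n. coeff f n \<in> \<real>" and "f \<noteq> 0"
  obtains R U where "splits_as f R U"
proof -
  define M where "M = proots f"
  define U where "U = filter_mset (\<lambda>z. Im z > 0) M"
  define R where "R = image_mset Re (filter_mset (\<lambda>z. Im z = 0) M)"
  have "filter_mset (\<lambda>z. Im z < 0) M = filter_mset (\<lambda>z. Im z < 0) (image_mset cnj M)"
    using proots_cnj[OF real] by (simp add: M_def)
  also have "\<dots> = image_mset cnj U" by (simp add: U_def filter_mset_image_mset)
  finally have low: "filter_mset (\<lambda>z. Im z < 0) M = image_mset cnj U" .
  have "image_mset complex_of_real R = image_mset (\<lambda>z. z) (filter_mset (\<lambda>z. Im z = 0) M)"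
    unfolding R_def image_mset.compositionality o_def
    by (intro image_mset_cong) (auto simp: complex_eq_iff)
  hence re: "image_mset complex_of_real R = filter_mset (\<lambda>z. Im z = 0) M" by simp
  have "M = image_mset complex_of_real R + U + image_mset cnj U"
    unfolding re unfolding low [symmetric] unfolding U_def by (rule multiset_eqI) auto
  with \<open>f \<noteq> 0\<close> have "splits_as f R U" by (auto simp: splits_as_def M_def U_def)
  thus ?thesis by (rule that)
qed

lemma count_of_real: "count (image_mset complex_of_real R) (complex_of_real x) = count R x"
  by (induction R) simp_all

lemma count_cnj: "count (image_mset cnj U) z = count U (cnj z)"
  by (induction U) (auto simp: complex_eq_iff)

lemma splits_order_real:
  assumes "splits_as f R U"
  shows "order (complex_of_real x) f = count R x"
proof -
  have "complex_of_real x \<notin># U" using assms by (force simp: splits_as_def)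
  hence "count U (complex_of_real x) = 0" by (simp add: not_in_iff)
  moreover have "order (complex_of_real x) f = count (image_mset complex_of_real R + U + image_mset cnj U) (complex_of_real x)"
    using assms by (metis count_proots splits_as_def)
  ultimately show ?thesis by (simp add: count_of_real count_cnj)
qed

lemma splits_order_nonreal:
  assumes "splits_as f R U" "Im z > 0"
  shows "order z f = count U z" "order (cnj z) f = count U z"
proof -
  have "z \<notin># image_mset complex_of_real R" "cnj z \<notin># image_mset complex_of_real R"
    using assms(2) by (auto simp: complex_eq_iff)
  moreover have "cnj z \<notin># U"
    using assms by (auto simp: splits_as_def dest!: bspec[of _ _ "cnj z"])
  ultimately
  have 0: "count (image_mset complex_of_real R) z = 0" "count (image_mset complex_of_real R) (cnj z) = 0" "count U (cnj z) = 0"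
    by (simp_all only: not_in_iff)
  have "order w f = count (image_mset complex_of_real R + U + image_mset cnj U) w" for w
    using assms by (metis count_proots splits_as_def)
  with 0 show "order z f = count U z" "order (cnj z) f = count U z"
    by (simp_all add: count_cnj)
qed

lemma splits_real_roots:
  assumes "splits_as f R U"
  shows "real_roots f = set_mset R"
proof -
  have "f \<noteq> 0" using assms by (simp add: splits_as_def)
  hence "poly f (of_real x) = 0 \<longleftrightarrow> x \<in># R" for x
    using splits_order_real[OF assms, of x] by (simp add: order_root)
  thus ?thesis by (auto simp: real_roots_def)
qed

lemma splits_nonreal_roots:
  assumes "splits_as f R U"
  shows "nonreal_roots f = set_mset U \<union> cnj ` set_mset U"
proof -
  have "f \<noteq> 0" and pr: "proots f = image_mset complex_of_real R + U + image_mset cnj U"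
    and im: "\<And>z. z \<in># U \<Longrightarrow> Im z > 0" using assms by (auto simp: splits_as_def)
  have "poly f z = 0 \<longleftrightarrow> z \<in># proots f" for z using \<open>f \<noteq> 0\<close> by simp
  thus ?thesis unfolding nonreal_roots_def pr by (fastforce simp: complex_is_Real_iff dest: im)
qed

lemma splits_size:
  assumes "splits_as f R U"
  shows "size R + 2 * size U = degree f"
  using assms size_proots_complex[of f] by (auto simp: splits_as_def)

lemma sum_orders:
  assumes real: "\<And>n. coeff f n \<in> \<real>" and "f \<noteq> 0"
  shows "finite (real_roots f)" "finite (nonreal_roots f)"
   "(\<Sum>x\<in>real_roots f. real_mult x f) + (\<Sum>z\<in>nonreal_roots f. order z f) = degree f"
proof -
  obtain R U where S: "splits_as f R U" using real_poly_splits[OF assms] .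
  have im: "\<And>z. z \<in># U \<Longrightarrow> Im z > 0" using S by (auto simp: splits_as_def)
  show "finite (real_roots f)" "finite (nonreal_roots f)"
    by (simp_all add: splits_real_roots[OF S] splits_nonreal_roots[OF S])
  have "(\<Sum>x\<in>real_roots f. real_mult x f) = size R"
    by (simp add: splits_real_roots[OF S] splits_order_real[OF S] size_multiset_overloaded_eq)
  moreover have "(\<Sum>z\<in>nonreal_roots f. order z f) = 2 * size U"
  proof -
    have "(\<Sum>z\<in>nonreal_roots f. order z f) = (\<Sum>z\<in>set_mset U. order z f) + (\<Sum>z\<in>cnj ` set_mset U. order z f)"
      unfolding splits_nonreal_roots[OF S] by (rule sum.union_disjoint) (fastforce dest: im)+
    also have "(\<Sum>z\<in>cnj ` set_mset U. order z f) = (\<Sum>z\<in>set_mset U. order (cnj z) f)"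
      by (subst sum.reindex) (simp_all add: inj_on_def)
    finally show ?thesis
      by (simp add: size_multiset_overloaded_eq splits_order_nonreal[OF S im])
  qed
  ultimately show "(\<Sum>x\<in>real_roots f. real_mult x f) + (\<Sum>z\<in>nonreal_roots f. order z f) = degree f"
    using splits_size[OF S] by simp
qed

lemma multiset_size2:
  assumes "size R = 2"
  obtains a b where "R = {#a, b#}"
proof -
  obtain a R' where "R = add_mset a R'" using assms by (cases R) auto
  moreover obtain b where "R' = {#b#}" using assms calculation by (cases R') auto
  ultimately show thesis by (auto intro: that)
qed

text \<open>The five partitions of 4, which are the possible patterns of four real roots.\<close>

lemma multiset_size4_cases:
  assumes "size (R :: 'a multiset) = 4"
  obtains a b c d where "R = {#a,b,c,d#}" "distinct [a,b,c,d]"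
   | d a b where "R = {#d,d,a,b#}" "distinct [d,a,b]"
   | a b where "R = {#a,a,b,b#}" "a \<noteq> b"
   | t a where "R = {#t,t,t,a#}" "t \<noteq> a"
   | t where "R = {#t,t,t,t#}"
proof -
  have "\<exists>a b c d. R = {#a,b,c,d#}"
  proof -
    obtain a R1 where 1: "R = add_mset a R1" using assms by (cases R) auto
    obtain b R2 where 2: "R1 = add_mset b R2" using assms 1 by (cases R1) auto
    obtain c R3 where 3: "R2 = add_mset c R3" using assms 1 2 by (cases R2) auto
    obtain d where "R3 = {#d#}" using assms 1 2 3 by (cases R3) auto
    with 1 2 3 show ?thesis by blast
  qed
  then obtain a b c d where R: "R = {#a,b,c,d#}" by blast
  show thesis
  proof (cases "distinct [a,b,c,d]")
    case False
    then consider "a = b" | "a = c" | "a = d" | "b = c" | "b = d" | "c = d" by auto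
    then have "R = {#a,a,c,d#} \<or> R = {#a,a,b,d#} \<or> R = {#a,a,b,c#} \<or> R = {#b,b,a,d#} \<or> R = {#b,b,a,c#}
        \<or> R = {#c,c,a,b#}"
      by cases (simp_all add: R add_mset_commute)
    then obtain d x y where R: "R = {#d,d,x,y#}" by metis
    consider "distinct [d,x,y]" | "d \<noteq> x" "x = y" | "d = x" "x \<noteq> y" | "d = y" "x \<noteq> y" | "d = x" "x = y"
      by auto
    then show thesis
    proof cases
      case 4 
      hence "R = {#d,d,d,x#}" "d \<noteq> x" by (auto simp: R add_mset_commute)
      thus ?thesis by (rule that(4))
    qed (use R that in blast)+
  qed (use R that in blast)
qed

section \<open>The nine patterns of roots and their separation\<close>

text \<open>Once every quartic is known to have some pattern together with the matching sign condition, the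
  nine equivalences between patterns and sign conditions follow at one stroke from the fact that each
  of the two families consists of mutually exclusive conditions.\<close>

datatype root_type = Four_Real | Two_Real | No_Real | Double_Two_Singles | Double_Pair
  | Two_Doubles | Double_Pairs | Triple_Single | Quadruple

fun has_type :: "root_type \<Rightarrow> complex poly \<Rightarrow> bool" where
  "has_type Four_Real f \<longleftrightarrow> card (real_roots f) = 4"
| "has_type Two_Real f \<longleftrightarrow> (\<exists>a b z. a \<noteq> b \<and> real_roots f = {a, b} \<and> real_mult a f = 1 \<and> real_mult b f = 1
          \<and> nonreal_roots f = {z, cnj z})"
| "has_type No_Real f \<longleftrightarrow> card (nonreal_roots f) = 4 \<and> (\<forall>z\<in>nonreal_roots f. order z f = 1)"
| "has_type Double_Two_Singles f \<longleftrightarrow> (\<exists>d a b. distinct [d, a, b] \<and> real_roots f = {d, a, b}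
          \<and> real_mult d f = 2 \<and> real_mult a f = 1 \<and> real_mult b f = 1)"
| "has_type Double_Pair f \<longleftrightarrow> (\<exists>d z. real_roots f = {d} \<and> real_mult d f = 2
          \<and> nonreal_roots f = {z, cnj z} \<and> order z f = 1 \<and> order (cnj z) f = 1)"
| "has_type Two_Doubles f \<longleftrightarrow> (\<exists>a b. a \<noteq> b \<and> real_roots f = {a, b} \<and> real_mult a f = 2 \<and> real_mult b f = 2)"
| "has_type Double_Pairs f \<longleftrightarrow> (\<exists>z. nonreal_roots f = {z, cnj z} \<and> order z f = 2 \<and> order (cnj z) f = 2)"
| "has_type Triple_Single f \<longleftrightarrow> (\<exists>t a. real_roots f = {t, a} \<and> real_mult t f = 3 \<and> real_mult a f = 1)"
| "has_type Quadruple f \<longleftrightarrow> (\<exists>z. order z f = 4)"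

text \<open>Here \<open>\<Delta>\<close> stands for \<open>3*p^2 - 8*q\<close> and \<open>\<delta>\<close> for \<open>p^3 - 4*p*q + 8*r\<close>.\<close>

fun sign_cond :: "root_type \<Rightarrow> real \<Rightarrow> real \<Rightarrow> real \<Rightarrow> real \<Rightarrow> bool" where
  "sign_cond Four_Real D L1 \<Delta> \<delta> \<longleftrightarrow> \<Delta> > 0 \<and> L1 > 0 \<and> D > 0"
| "sign_cond Two_Real D L1 \<Delta> \<delta> \<longleftrightarrow> D < 0"
| "sign_cond No_Real D L1 \<Delta> \<delta> \<longleftrightarrow> D > 0 \<and> (\<Delta> \<le> 0 \<or> L1 \<le> 0)"
| "sign_cond Double_Two_Singles D L1 \<Delta> \<delta> \<longleftrightarrow> D = 0 \<and> L1 > 0"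
| "sign_cond Double_Pair D L1 \<Delta> \<delta> \<longleftrightarrow> D = 0 \<and> L1 < 0"
| "sign_cond Two_Doubles D L1 \<Delta> \<delta> \<longleftrightarrow> D = 0 \<and> L1 = 0 \<and> \<Delta> > 0 \<and> \<delta> = 0"
| "sign_cond Double_Pairs D L1 \<Delta> \<delta> \<longleftrightarrow> D = 0 \<and> L1 = 0 \<and> \<Delta> < 0"
| "sign_cond Triple_Single D L1 \<Delta> \<delta> \<longleftrightarrow> D = 0 \<and> L1 = 0 \<and> \<Delta> > 0 \<and> \<delta> \<noteq> 0"
| "sign_cond Quadruple D L1 \<Delta> \<delta> \<longleftrightarrow> D = 0 \<and> L1 = 0 \<and> \<Delta> = 0"

lemma sign_cond_unique:
  assumes "sign_cond T D L1 \<Delta> \<delta>" "sign_cond T' D L1 \<Delta> \<delta>"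
  shows "T = T'"
  using assms by (cases T; cases T') auto

text \<open>The numbers of distinct real and of distinct non-real roots.\<close>

fun root_counts :: "root_type \<Rightarrow> nat \<times> nat" where
  "root_counts Four_Real = (4, 0)"
| "root_counts Two_Real = (2, 2)"
| "root_counts No_Real = (0, 4)"
| "root_counts Double_Two_Singles = (3, 0)"
| "root_counts Double_Pair = (1, 2)"
| "root_counts Two_Doubles = (2, 0)"
| "root_counts Double_Pairs = (0, 2)"
| "root_counts Triple_Single = (2, 0)"
| "root_counts Quadruple = (1, 0)"

text \<open>Some patterns mention only the real or only the non-real roots; that nothing else is left follows
  because the multiplicities add up to 4. A quadruple root must be real since otherwise its conjugate
  would have multiplicity 4 as well.\<close>

lemma has_type_counts:
  assumes real: "\<And>n. coeff f n \<in> \<real>" and deg: "degree f = 4" and T: "has_type T f"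
  shows "(card (real_roots f), card (nonreal_roots f)) = root_counts T"
proof -
  have f0: "f \<noteq> 0" using deg by auto
  have fin: "finite (real_roots f)" "finite (nonreal_roots f)"
    and tot: "(\<Sum>x\<in>real_roots f. real_mult x f) + (\<Sum>z\<in>nonreal_roots f. order z f) = 4"
    using sum_orders[OF real f0] deg by auto
  have pos: "real_mult x f \<ge> 1" if "x \<in> real_roots f" for x
    using that f0 by (simp add: real_roots_def order_root Suc_le_eq)
  have posn: "order z f \<ge> 1" if "z \<in> nonreal_roots f" for z
    using that f0 by (simp add: nonreal_roots_def order_root Suc_le_eq)
  have leR: "card (real_roots f) \<le> (\<Sum>x\<in>real_roots f. real_mult x f)"
    using sum_mono[of "real_roots f" "\<lambda>_. 1" "\<lambda>x. real_mult x f"] pos by simp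
  have leN: "card (nonreal_roots f) \<le> (\<Sum>z\<in>nonreal_roots f. order z f)"
    using sum_mono[of "nonreal_roots f" "\<lambda>_. 1" "\<lambda>z. order z f"] posn by simp
  have pair: "z \<noteq> cnj z" if "z \<in> nonreal_roots f" for z
    using that by (auto simp: nonreal_roots_def Reals_cnj_iff)
  show ?thesis
  proof (cases T)
    case Four_Real
    thus ?thesis using T tot leR leN by simp
  next
    case Two_Real
    then obtain a b z where "a \<noteq> b" "real_roots f = {a, b}" "nonreal_roots f = {z, cnj z}" using T by auto
    thus ?thesis using pair[of z] by (simp add: Two_Real)
  next
    case No_Real
    thus ?thesis using T tot leR leN by simp
  next
    case Double_Two_Singles
    then obtain d a b where "distinct [d, a, b]" "real_roots f = {d, a, b}"
          "real_mult d f = 2" "real_mult a f = 1" "real_mult b f = 1" using T by auto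
    thus ?thesis using tot leN by (simp add: Double_Two_Singles)
  next
    case Double_Pair
    then obtain d z where "real_roots f = {d}" "nonreal_roots f = {z, cnj z}" using T by auto
    thus ?thesis using pair[of z] by (simp add: Double_Pair)
  next
    case Two_Doubles
    then obtain a b where "a \<noteq> b" "real_roots f = {a, b}" "real_mult a f = 2" "real_mult b f = 2" using T by auto
    thus ?thesis using tot leN by (simp add: Two_Doubles)
  next
    case Double_Pairs
    then obtain z where z: "nonreal_roots f = {z, cnj z}" "order z f = 2" "order (cnj z) f = 2" using T by auto
    thus ?thesis using pair[of z] tot leR by (simp add: Double_Pairs)
  next
    case Triple_Single
    then obtain t a where ta: "real_roots f = {t, a}" "real_mult t f = 3" "real_mult a f = 1" using T by auto
    hence "t \<noteq> a" by auto
    thus ?thesis using ta tot leN by (simp add: Triple_Single)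
  next
    case Quadruple
    then obtain z where z: "order z f = 4" using T by auto
    have "count (image_mset cnj (proots f)) z = 4" using proots_cnj[OF real] z f0 by simp
    hence cz: "order (cnj z) f = 4" using f0 by (simp add: count_cnj)
    have root: "poly f z = 0" using z f0 by (simp add: order_root)
    have "z \<in> \<real>"
    proof (rule ccontr)
      assume "z \<notin> \<real>"
      hence "{z, cnj z} \<subseteq> nonreal_roots f" "z \<noteq> cnj z"
        using root z cz f0 by (auto simp: nonreal_roots_def order_root Reals_cnj_iff)
      hence "(\<Sum>w\<in>{z, cnj z}. order w f) \<le> 4"
        using sum_mono2[OF fin(2), of "{z, cnj z}" "\<lambda>w. order w f"] tot by simp
      thus False using z cz \<open>z \<noteq> cnj z\<close> by simp
    qed
    then obtain x where x: "z = complex_of_real x" by (auto elim: Reals_cases)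
    have "x \<in> real_roots f" using root x by (simp add: real_roots_def)
    hence "(\<Sum>x\<in>real_roots f. real_mult x f) = 4 + (\<Sum>x\<in>real_roots f - {x}. real_mult x f)"
      using fin(1) z x by (simp add: sum.remove)
    moreover have "card (real_roots f - {x}) \<le> (\<Sum>x\<in>real_roots f - {x}. real_mult x f)"
      using sum_mono[of "real_roots f - {x}" "\<lambda>_. 1" "\<lambda>x. real_mult x f"] pos by simp
    ultimately have "card (real_roots f - {x}) = 0" "card (nonreal_roots f) = 0" using tot leN by linarith+
    moreover have "card (real_roots f) = Suc (card (real_roots f - {x}))"
      using fin(1) \<open>x \<in> real_roots f\<close> by (rule card.remove)
    ultimately show ?thesis by (simp add: Quadruple)
  qed
qed

text \<open>The numbers of real and non-real roots separate all patterns but two double roots and a triple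
  and a single one, which the multiplicities of the real roots tell apart.\<close>

lemma has_type_unique:
  assumes "\<And>n. coeff f n \<in> \<real>" "degree f = 4" "has_type T f" "has_type T' f"
  shows "T = T'"
proof -
  have "\<not> (has_type Two_Doubles f \<and> has_type Triple_Single f)" 
    by (auto simp: doubleton_eq_iff)
  moreover have "root_counts T = root_counts T'"
    using has_type_counts[OF assms(1,2,3)] has_type_counts[OF assms(1,2,4)] by simp
  ultimately show ?thesis using assms(3,4) by (cases T; cases T') (simp_all del: has_type.simps)
qed

section \<open>Classification\<close>

lemma vieta_of_splits:
  assumes f: "f = map_poly complex_of_real [:s, r, q, p, 1:]" and "splits_as f R U"
   "image_mset complex_of_real R + U + image_mset cnj U = {#a,b,c,d#}"
  shows "vieta (complex_of_real p) (of_real q) (of_real r) (of_real s) a b c d"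
proof -
  have f: "f = [:of_real s, of_real r, of_real q, of_real p, 1:]" unfolding f by (simp add: map_poly_pCons)
  have "f = smult (lead_coeff f) (\<Prod>x\<in>#{#a,b,c,d#}. [:-x, 1:])"
    using complex_poly_decompose_multiset[of f] assms(2,3) by (simp add: splits_as_def)
  also have "lead_coeff f = 1" by (simp add: f)
  also have "smult 1 (\<Prod>x\<in>#{#a,b,c,d#}. [:-x, 1:]) = [:a*b*c*d, -(a*b*c + a*b*d + a*c*d + b*c*d),
       a*b + a*c + a*d + b*c + b*d + c*d, -(a + b + c + d), 1:]"
    by (simp, intro conjI; algebra)
  finally show ?thesis unfolding f vieta_def by simp
qed

context
  fixes p q r s :: real and f :: "complex poly"
  assumes f: "f = map_poly complex_of_real [:s, r, q, p, 1:]"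
begin

lemma coeff_real: "coeff f n \<in> \<real>"
  by (simp add: f coeff_map_poly)

lemma degree_4: "degree f = 4"
  unfolding f by (subst degree_map_poly) simp_all

lemma f_nonzero: "f \<noteq> 0"
  using degree_4 by auto

lemma vieta_real_splits:
  assumes "splits_as f {#a,b,c,d#} {#}"
  shows "vieta p q r s a b c d"
  using vieta_of_splits[OF f assms, of "of_real a" "of_real b" "of_real c" "of_real d"]
  by (simp add: vieta_of_real)

lemma root_type_exists:
  "\<exists>T. has_type T f \<and> sign_cond T (quartic_disc p q r s) (quartic_L1 p q r s) (3*p^2 - 8*q) (p^3 - 4*p*q + 8*r)"
proof -
  obtain R U where S: "splits_as f R U"
    using real_poly_splits[of f] coeff_real f_nonzero by blast
  have im: "\<And>z. z \<in># U \<Longrightarrow> Im z > 0" using S by (auto simp: splits_as_def)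
  note roots = splits_real_roots[OF S] splits_nonreal_roots[OF S] splits_order_real[OF S]
    splits_order_nonreal[OF S]
  have "size R + 2 * size U = 4" using splits_size[OF S] by (simp add: degree_4)
  moreover from this have "size U = 0 \<or> size U = 1 \<or> size U = 2" by linarith
  ultimately consider "size R = 4" "U = {#}" | "size R = 2" "size U = 1" | "R = {#}" "size U = 2"
    by auto
  thus ?thesis
  proof cases
    case 1
    note S' = S[unfolded \<open>U = {#}\<close>]
    from \<open>size R = 4\<close> show ?thesis
    proof (cases rule: multiset_size4_cases)
      case (1 a b c d)
      have "has_type Four_Real f" using 1(2) by (simp add: roots 1(1))
      with signs_four_real[OF vieta_real_splits 1(2)] S' 1(1) show ?thesis
        by (intro exI[of _ Four_Real]) simp
    next
      case (2 d a b)
      have "has_type Double_Two_Singles f" unfolding has_type.simps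
        using 2(2) by (intro exI[of _ d] exI[of _ a] exI[of _ b]) (simp add: roots 2(1))
      with signs_double_singles[OF vieta_real_splits 2(2)] S' 2(1) show ?thesis
        by (intro exI[of _ Double_Two_Singles]) simp
    next
      case (3 a b)
      have "has_type Two_Doubles f" unfolding has_type.simps
        using 3(2) by (intro exI[of _ a] exI[of _ b]) (simp add: roots 3(1))
      with signs_two_doubles[OF vieta_real_splits 3(2)] S' 3(1) show ?thesis
        by (intro exI[of _ Two_Doubles]) simp
    next
      case (4 t a)
      have "has_type Triple_Single f" unfolding has_type.simps
        using 4(2) by (intro exI[of _ t] exI[of _ a]) (simp add: roots 4(1))
      with signs_triple_single[OF vieta_real_splits 4(2)] S' 4 show ?thesis
        by (intro exI[of _ Triple_Single]) simp
    next
      case (5 t)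
      have "has_type Quadruple f" unfolding has_type.simps
        by (intro exI[of _ "of_real t"]) (simp add: roots 5)
      with signs_quadruple[OF vieta_real_splits] S' 5(1) show ?thesis
        by (intro exI[of _ Quadruple]) simp
    qed
  next
    case 2
    then obtain a b z where R: "R = {#a, b#}" and U: "U = {#z#}"
      by (metis multiset_size2 size_1_singleton_mset)
    have z: "Im z > 0" using im by (simp add: U)
    have v: "vieta (complex_of_real p) (of_real q) (of_real r) (of_real s) (of_real a) (of_real b) z (cnj z)"
      by (rule vieta_of_splits[OF f S]) (simp add: R U)
    show ?thesis
    proof (cases "a = b")
      case True
      have "has_type Double_Pair f" unfolding has_type.simps
        using z by (intro exI[of _ a] exI[of _ z]) (auto simp: roots R U True)
      with signs_double_pair[OF v[folded True] z] show ?thesis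
        by (intro exI[of _ Double_Pair]) simp
    next
      case False
      have "has_type Two_Real f" unfolding has_type.simps
        using False by (intro exI[of _ a] exI[of _ b] exI[of _ z]) (auto simp: roots R U)
      with signs_two_singles_pair[OF v False z] show ?thesis
        by (intro exI[of _ Two_Real]) simp
    qed
  next
    case 3
    then obtain z w where U: "U = {#z, w#}"
      by (metis multiset_size2)
    have zw: "Im z > 0" "Im w > 0" using im by (simp_all add: U)
    have v: "vieta (complex_of_real p) (of_real q) (of_real r) (of_real s) z (cnj z) w (cnj w)"
      by (rule vieta_of_splits[OF f S]) (simp add: 3(1) U add_mset_commute)
    show ?thesis
    proof (cases "z = w")
      case True
      have "has_type Double_Pairs f" unfolding has_type.simps
        using zw by (intro exI[of _ z]) (auto simp: roots U True)
      with signs_double_pairs[of p q r s z] v True zw show ?thesis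
        by (intro exI[of _ Double_Pairs]) simp
    next
      case False
      have "z \<noteq> cnj w" "cnj z \<noteq> w" "z \<noteq> cnj z" "w \<noteq> cnj w" using zw by (auto simp: complex_eq_iff)
      hence "has_type No_Real f" using False zw by (auto simp: roots U card_insert_if)
      with signs_two_pairs[OF v False zw] show ?thesis
        by (intro exI[of _ No_Real]) simp
    qed
  qed
qed

text \<open>Some type satisfies both sides; by uniqueness on the side where \<open>T\<close> is known to hold, it is
  \<open>T\<close>.\<close>

lemma has_type_iff_sign_cond:
  "has_type T f \<longleftrightarrow> sign_cond T (quartic_disc p q r s) (quartic_L1 p q r s) (3*p^2 - 8*q) (p^3 - 4*p*q + 8*r)"
  using root_type_exists has_type_unique[OF coeff_real degree_4] sign_cond_unique by metis

section \<open>Position of the multiple root\<close>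

text \<open>Multiplicities of real roots that add up to the degree leave no room for other roots, so they
  determine the polynomial.\<close>

lemma four_real_mults_vieta:
  assumes "\<And>x. count {#a, b, c, d#} x \<le> real_mult x f"
  shows "vieta p q r s a b c d"
proof -
  obtain R U where S: "splits_as f R U"
    using real_poly_splits[of f] coeff_real f_nonzero by blast
  have "{#a, b, c, d#} \<subseteq># R"
    using assms by (intro mset_subset_eqI) (simp only: splits_order_real[OF S])
  moreover have sz: "size R + 2 * size U = 4" using splits_size[OF S] by (simp add: degree_4)
  ultimately have "R = {#a, b, c, d#}"
    using mset_subset_size[of "{#a, b, c, d#}" R] by (auto simp: subset_mset.less_le)
  moreover from this have "U = {#}" using sz by simp
  ultimately show ?thesis using S vieta_real_splits by blast
qed

lemma double_root_vieta:
  assumes "real_mult d f = 2" "real_mult a f = 1" "real_mult b f = 1" "a \<noteq> b"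
  shows "vieta p q r s d d a b"
proof -
  have "d \<noteq> a" "d \<noteq> b" using assms by auto
  thus ?thesis using assms by (intro four_real_mults_vieta) auto
qed

lemma triple_root_vieta:
  assumes "real_mult t f = 3" "real_mult a f = 1"
  shows "vieta p q r s t t t a"
proof -
  have "t \<noteq> a" using assms by auto
  thus ?thesis using assms by (intro four_real_mults_vieta) auto
qed

lemma double_root_order:
  fixes L1 C0 D2 D3 :: real
  assumes D: "quartic_disc p q r s = 0" and L: "quartic_L1 p q r s > 0"
    and L1: "L1 = quartic_L1 p q r s"
    and C0: "C0 = 48*r*s - 32*p*q*s - p^2*q*r + 9*p^3*s + 4*q^2*r - 3*p*r^2"
    and D2: "D2 = 3*C0^2 + 2*q*L1^2 + 3*p*C0*L1"
    and D3: "D3 = (8*r - 4*p*q + p^3) * (q^2 - 3*p*r + 12*s)"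
  shows "(\<exists>d a b. real_mult d f = 2 \<and> real_mult a f = 1 \<and> real_mult b f = 1 \<and> a < d \<and> d < b) \<longleftrightarrow> D2 < 0" (is ?A)
    and "(\<exists>d a b. real_mult d f = 2 \<and> real_mult a f = 1 \<and> real_mult b f = 1 \<and> d < a \<and> a < b) \<longleftrightarrow> D2 > 0 \<and> D3 < 0" (is ?B)
    and "(\<exists>d a b. real_mult d f = 2 \<and> real_mult a f = 1 \<and> real_mult b f = 1 \<and> a < b \<and> b < d) \<longleftrightarrow> D2 > 0 \<and> D3 > 0" (is ?C)
proof -
  have pos: "D2 = (2 * L1^2) * ((d-a) * (d-b))" "D3 = (2*d-a-b) * ((a-b) * (d-a) * (d-b))^2"
    if "real_mult d f = 2" "real_mult a f = 1" "real_mult b f = 1" "a \<noteq> b" for d a b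
  proof -
    note v = double_root_vieta[OF that]
    show "D2 = (2 * L1^2) * ((d-a) * (d-b))" "D3 = (2*d-a-b) * ((a-b) * (d-a) * (d-b))^2"
      unfolding D2 D3
      by (rule double_root_position[OF v], simp only: C0 L1 double_root_abscissa[OF v])+
  qed
  have sgn2: "D2 < 0 \<longleftrightarrow> (d-a) * (d-b) < 0" "D2 > 0 \<longleftrightarrow> (d-a) * (d-b) > 0"
    and sgn3: "D3 < 0 \<longleftrightarrow> 2*d < a + b" "D3 > 0 \<longleftrightarrow> 2*d > a + b"
    if m: "real_mult d f = 2" "real_mult a f = 1" "real_mult b f = 1" "a \<noteq> b" for d a b
  proof -
    have "2 * L1^2 > 0" using L by (simp add: L1)
    thus "D2 < 0 \<longleftrightarrow> (d-a) * (d-b) < 0" "D2 > 0 \<longleftrightarrow> (d-a) * (d-b) > 0"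
      unfolding pos[OF m] by (simp_all only: mult_less_0_iff zero_less_mult_iff) auto
    have "d \<noteq> a" "d \<noteq> b" using m by auto
    with m have "((a-b) * (d-a) * (d-b))^2 > 0" by simp
    thus "D3 < 0 \<longleftrightarrow> 2*d < a + b" "D3 > 0 \<longleftrightarrow> 2*d > a + b"
      unfolding pos[OF m] using mult_less_0_iff zero_less_mult_iff by (smt (verit))+
  qed
  have "has_type Double_Two_Singles f" using D L by (simp only: has_type_iff_sign_cond sign_cond.simps)
  then obtain d a b where m: "real_mult d f = 2" "real_mult a f = 1" "real_mult b f = 1" and ab: "a < b"
    and ne: "d \<noteq> a" "d \<noteq> b"
    unfolding has_type.simps by (metis distinct_length_2_or_more linorder_neqE_linordered_idom)
  (* Exactly one of the three arrangements occurs, and likewise for the sign conditions. *)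
  have s: "D2 < 0 \<longleftrightarrow> a < d \<and> d < b" "D2 > 0 \<and> D3 < 0 \<longleftrightarrow> d < a" "D2 > 0 \<and> D3 > 0 \<longleftrightarrow> b < d"
    using ab ne sgn2[OF m] sgn3[OF m] by (auto simp: mult_less_0_iff zero_less_mult_iff)
  show ?A
  proof
    assume "\<exists>d a b. real_mult d f = 2 \<and> real_mult a f = 1 \<and> real_mult b f = 1 \<and> a < d \<and> d < b"
    then obtain d a b where h: "real_mult d f = 2" "real_mult a f = 1" "real_mult b f = 1" "a < d" "d < b" by blast
    thus "D2 < 0" using sgn2(1)[OF h(1-3)] by (simp add: mult_less_0_iff)
  qed (use m s in blast)
  show ?B
  proof
    assume "\<exists>d a b. real_mult d f = 2 \<and> real_mult a f = 1 \<and> real_mult b f = 1 \<and> d < a \<and> a < b"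
    then obtain d a b where h: "real_mult d f = 2" "real_mult a f = 1" "real_mult b f = 1" "d < a" "a < b" by blast
    thus "D2 > 0 \<and> D3 < 0" using sgn2(2)[OF h(1-3)] sgn3(1)[OF h(1-3)] by (simp add: zero_less_mult_iff)
  qed (use m s ab in blast)
  show ?C
  proof
    assume "\<exists>d a b. real_mult d f = 2 \<and> real_mult a f = 1 \<and> real_mult b f = 1 \<and> a < b \<and> b < d"
    then obtain d a b where h: "real_mult d f = 2" "real_mult a f = 1" "real_mult b f = 1" "a < b" "b < d" by blast
    thus "D2 > 0 \<and> D3 > 0" using sgn2(2)[OF h(1-3)] sgn3(2)[OF h(1-3)] by (simp add: zero_less_mult_iff)
  qed (use m s ab in blast)
qed

lemma triple_root_order:
  fixes \<delta> :: real
  assumes c: "quartic_disc p q r s = 0" "quartic_L1 p q r s = 0" "3*p^2 - 8*q > 0" "p^3 - 4*p*q + 8*r \<noteq> 0"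
  defines "\<delta> \<equiv> p^3 - 4*p*q + 8*r"
  shows "(\<exists>t a. real_mult t f = 3 \<and> real_mult a f = 1 \<and> t < a) \<longleftrightarrow> \<delta> < 0" (is ?A)
    and "(\<exists>t a. real_mult t f = 3 \<and> real_mult a f = 1 \<and> a < t) \<longleftrightarrow> \<delta> > 0" (is ?B)
proof -
  have pos: "\<delta> < 0 \<longleftrightarrow> t < a" "\<delta> > 0 \<longleftrightarrow> a < t"
    if m: "real_mult t f = 3" "real_mult a f = 1" for t a
  proof -
    have "t \<noteq> a" using m by auto
    hence "\<delta> = (t - a)^3" unfolding \<delta>_def by (rule signs_triple_single(4)[OF triple_root_vieta[OF m]])
    thus "\<delta> < 0 \<longleftrightarrow> t < a" "\<delta> > 0 \<longleftrightarrow> a < t" by (simp_all add: power_less_zero_eq zero_less_power_eq)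
  qed
  have "has_type Triple_Single f" using c by (simp add: has_type_iff_sign_cond del: has_type.simps)
  then obtain t a where "real_mult t f = 3" "real_mult a f = 1" by auto
  with pos show ?A ?B by blast+
qed

end

section \<open>The classification of real quartics by signs\<close>

theorem mainTheorem3:
  fixes p q r s D L1 C0 D2 D3 :: real and f :: "complex poly"
  assumes f_def: "f = map_poly complex_of_real [:s, r, q, p, 1:]"
    and D_def: "D = 18*p^3*q*r*s - 4*p^2*q^3*s + 144*q*r^2*s + p^2*q^2*r^2 - 192*p*r*s^2
        + 144*p^2*q*s^2 + 18*p*q*r^3 - 4*p^3*r^3 - 128*q^2*s^2
        + 16*q^4*s - 4*q^3*r^2 - 27*p^4*s^2 - 80*p*q^2*r*s - 6*p^2*r^2*s + 256*s^3 - 27*r^4"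
    and L1_def: "L1 = p^2*q^2 - 3*p^3*r - 6*p^2*s - 4*q^3 + 14*p*q*r + 16*q*s - 18*r^2"
    and C0_def: "C0 = 48*r*s - 32*p*q*s - p^2*q*r + 9*p^3*s + 4*q^2*r - 3*p*r^2"
    and D2_def: "D2 = 3*C0^2 + 2*q*L1^2 + 3*p*C0*L1"
    and D3_def: "D3 = (8*r - 4*p*q + p^3) * (q^2 - 3*p*r + 12*s)"
  shows
    "(card (real_roots f) = 4 \<longleftrightarrow> 3*p^2 - 8*q > 0 \<and> L1 > 0 \<and> D > 0)
   \<and> ((\<exists>a b z. a \<noteq> b \<and> real_roots f = {a, b} \<and> real_mult a f = 1 \<and> real_mult b f = 1
          \<and> nonreal_roots f = {z, cnj z})
        \<longleftrightarrow> D < 0)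
   \<and> (card (nonreal_roots f) = 4 \<and> (\<forall>z\<in>nonreal_roots f. order z f = 1)
        \<longleftrightarrow> D > 0 \<and> (3*p^2 - 8*q \<le> 0 \<or> L1 \<le> 0))
   \<and> ((\<exists>d a b. distinct [d, a, b] \<and> real_roots f = {d, a, b}
          \<and> real_mult d f = 2 \<and> real_mult a f = 1 \<and> real_mult b f = 1)
        \<longleftrightarrow> D = 0 \<and> L1 > 0)
   \<and> (D = 0 \<and> L1 > 0 \<longrightarrow>
        ((\<exists>d a b. real_mult d f = 2 \<and> real_mult a f = 1 \<and> real_mult b f = 1 \<and> a < d \<and> d < b)
          \<longleftrightarrow> D2 < 0)
      \<and> ((\<exists>d a b. real_mult d f = 2 \<and> real_mult a f = 1 \<and> real_mult b f = 1 \<and> d < a \<and> a < b)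
          \<longleftrightarrow> D2 > 0 \<and> D3 < 0)
      \<and> ((\<exists>d a b. real_mult d f = 2 \<and> real_mult a f = 1 \<and> real_mult b f = 1 \<and> a < b \<and> b < d)
          \<longleftrightarrow> D2 > 0 \<and> D3 > 0))
   \<and> ((\<exists>d z. real_roots f = {d} \<and> real_mult d f = 2
          \<and> nonreal_roots f = {z, cnj z} \<and> order z f = 1 \<and> order (cnj z) f = 1)
        \<longleftrightarrow> D = 0 \<and> L1 < 0)
   \<and> ((\<exists>a b. a \<noteq> b \<and> real_roots f = {a, b} \<and> real_mult a f = 2 \<and> real_mult b f = 2)
        \<longleftrightarrow> D = 0 \<and> L1 = 0 \<and> 3*p^2 - 8*q > 0 \<and> p^3 - 4*p*q + 8*r = 0)
   \<and> ((\<exists>z. nonreal_roots f = {z, cnj z} \<and> order z f = 2 \<and> order (cnj z) f = 2)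
        \<longleftrightarrow> D = 0 \<and> L1 = 0 \<and> 3*p^2 - 8*q < 0)
   \<and> ((\<exists>t a. real_roots f = {t, a} \<and> real_mult t f = 3 \<and> real_mult a f = 1)
        \<longleftrightarrow> D = 0 \<and> L1 = 0 \<and> 3*p^2 - 8*q > 0 \<and> p^3 - 4*p*q + 8*r \<noteq> 0)
   \<and> (D = 0 \<and> L1 = 0 \<and> 3*p^2 - 8*q > 0 \<and> p^3 - 4*p*q + 8*r \<noteq> 0 \<longrightarrow>
        ((\<exists>t a. real_mult t f = 3 \<and> real_mult a f = 1 \<and> t < a) \<longleftrightarrow> p^3 - 4*p*q + 8*r < 0)
      \<and> ((\<exists>t a. real_mult t f = 3 \<and> real_mult a f = 1 \<and> a < t) \<longleftrightarrow> p^3 - 4*p*q + 8*r > 0))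
   \<and> ((\<exists>z. order z f = 4) \<longleftrightarrow> D = 0 \<and> L1 = 0 \<and> 3*p^2 - 8*q = 0)"
proof -
  have D: "D = quartic_disc p q r s" and L1: "L1 = quartic_L1 p q r s"
    by (simp_all only: D_def L1_def quartic_disc_def quartic_L1_def)
  note iff = has_type_iff_sign_cond[OF f_def, folded D L1]
  show ?thesis
    using iff[of Four_Real] iff[of Two_Real] iff[of No_Real] iff[of Double_Two_Singles]
      iff[of Double_Pair] iff[of Two_Doubles] iff[of Double_Pairs] iff[of Triple_Single] iff[of Quadruple]
      double_root_order[OF f_def _ _ L1 C0_def D2_def D3_def, folded D L1]
      triple_root_order[OF f_def, folded D L1]
    unfolding has_type.simps sign_cond.simps
    by (intro conjI impI) (elim conjE, assumption | blast)+
qed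

end
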